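(* Let $\lambda,\mu\in\mathbb{C}^*$ and $\alpha\in\mathbb{C}$. On the vector space $\Omega(\lambda,\mu,\alpha):=\mathbb{C}[t]$ define, for $f(t)\in\mathbb{C}[t]$ and $(i,j)\in\mathbb{Z}^2$, $$L_{i,j}\cdot f(t)=\lambda^{i-j}\mu^j(t-i\alpha)f(t-i),\qquad C_i\cdot f(t)=0.$$ Then this action makes $\Omega(\lambda,\mu,\alpha)$ a module over the loop-Virasoro algebra $\mathfrak{L}$.
   Context: All vector spaces and Lie algebras are over $\mathbb{C}$; $\mathbb{C}^*$ denotes the nonzero complex numbers. The Virasoro algebra $\mathfrak{V}$ has basis $\{L_i, C\mid i\in\mathbb{Z}\}$ and relations $[L_i,L_j]=(j-i)L_{i+j}+\delta_{i+j,0}\frac{i^3-i}{12}C$, $[L_i,C]=0$. The loop-Virasoro algebra is $\mathfrak{L}=\mathfrak{V}\otimes\mathbb{C}[t^{\pm1}]$, with basis $\{L_{i,j}:=L_i\otimes t^j,\ C_j:=C\otimes t^j\mid (i,j)\in\mathbb{Z}^2\}$ and relations, for all $i,j,k,l\in\mathbb{Z}$, $$[L_{i,j},L_{k,l}]=(k-i)L_{i+k,j+l}+\delta_{i+k,0}\frac{i^3-i}{12}C_{j+l},\qquad [L_{i,j},C_l]=0,\qquad [C_j,C_l]=0.$$ *)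

theory Defs
  imports
    Complex_Main
    "HOL-Library.Poly_Mapping"
    "HOL-Computational_Algebra.Polynomial"
begin

section \<open>Lie algebras and their modules\<close>

locale lie_algebra = vector_space scale
  for scale :: "'k::field \<Rightarrow> 'g::ab_group_add \<Rightarrow> 'g" +
  fixes bracket :: "'g \<Rightarrow> 'g \<Rightarrow> 'g"
  assumes linear_bracket_left: "Vector_Spaces.linear scale scale (\<lambda>x. bracket x y)"
    and linear_bracket_right: "Vector_Spaces.linear scale scale (\<lambda>y. bracket x y)"
    and bracket_self: "bracket x x = 0"
    and jacobi: "bracket x (bracket y z) + bracket y (bracket z x) + bracket z (bracket x y) = 0"

locale lie_module = lie_algebra scale bracket + M: vector_space scaleM
  for scale :: "'k::field \<Rightarrow> 'g::ab_group_add \<Rightarrow> 'g"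
    and bracket :: "'g \<Rightarrow> 'g \<Rightarrow> 'g"
    and scaleM :: "'k \<Rightarrow> 'm::ab_group_add \<Rightarrow> 'm" +
  fixes act :: "'g \<Rightarrow> 'm \<Rightarrow> 'm"
  assumes linear_act_left: "Vector_Spaces.linear scale scaleM (\<lambda>x. act x v)"
    and linear_act_right: "Vector_Spaces.linear scaleM scaleM (\<lambda>v. act x v)"
    and act_bracket: "act (bracket x y) v = act x (act y v) - act y (act x v)"


section \<open>Free vector spaces and linear extension\<close>

text \<open>The type \<open>'a \<Rightarrow>\<^sub>0 'k\<close> of finitely supported functions is the vector space over \<open>'k\<close>
  with basis \<open>'a\<close>; the basis vector of \<open>a\<close> is \<open>Poly_Mapping.single a 1\<close>.\<close>

definition pm_scale :: "'k::field \<Rightarrow> ('a \<Rightarrow>\<^sub>0 'k) \<Rightarrow> ('a \<Rightarrow>\<^sub>0 'k)" where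
  "pm_scale c = Poly_Mapping.map ((*) c)"

definition lin_ext :: "('k::field \<Rightarrow> 'm::ab_group_add \<Rightarrow> 'm) \<Rightarrow> ('a \<Rightarrow> 'm) \<Rightarrow> ('a \<Rightarrow>\<^sub>0 'k) \<Rightarrow> 'm" where
  "lin_ext scaleM \<phi> x =
     (\<Sum>a\<in>Poly_Mapping.keys x. scaleM (Poly_Mapping.lookup x a) (\<phi> a))"

lemma lookup_pm_scale [simp]:
  "Poly_Mapping.lookup (pm_scale c x) a = c * Poly_Mapping.lookup x a"
  by (simp add: pm_scale_def Poly_Mapping.map.rep_eq when_def)

lemma pm_scale_single [simp]:
  "pm_scale c (Poly_Mapping.single a d) = Poly_Mapping.single a (c * d)"
  by (rule poly_mapping_eqI) (simp add: lookup_single when_def)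

lemma vector_space_pm_scale: "vector_space pm_scale"
  by unfold_locales (rule poly_mapping_eqI, simp add: lookup_add algebra_simps)+

lemma vector_space_smult: "vector_space (smult :: 'k::field \<Rightarrow> 'k poly \<Rightarrow> 'k poly)"
  by unfold_locales (simp_all add: smult_add_right smult_add_left)

lemma lin_ext_superset:
  assumes "vector_space scaleM" "finite S" "Poly_Mapping.keys x \<subseteq> S"
  shows "lin_ext scaleM \<phi> x = (\<Sum>a\<in>S. scaleM (Poly_Mapping.lookup x a) (\<phi> a))"
proof -
  interpret vector_space scaleM by fact
  show ?thesis unfolding lin_ext_def
    by (rule sum.mono_neutral_left) (use assms in \<open>auto simp: in_keys_iff\<close>)
qed

lemma linear_lin_ext:
  assumes "vector_space scaleM"
  shows "Vector_Spaces.linear pm_scale scaleM (lin_ext scaleM \<phi>)"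
proof -
  interpret vector_space scaleM by fact
  have "lin_ext scaleM \<phi> (x + y) = lin_ext scaleM \<phi> x + lin_ext scaleM \<phi> y" for x y
  proof -
    let ?S = "Poly_Mapping.keys x \<union> Poly_Mapping.keys y"
    have "Poly_Mapping.keys (x + y) \<subseteq> ?S" by (rule Poly_Mapping.keys_add)
    then show ?thesis
      by (simp add: lin_ext_superset[OF assms, of ?S] lookup_add scale_left_distrib sum.distrib)
  qed
  moreover have "lin_ext scaleM \<phi> (pm_scale c x) = scaleM c (lin_ext scaleM \<phi> x)" for c x
  proof -
    have "Poly_Mapping.keys (pm_scale c x) \<subseteq> Poly_Mapping.keys x" by (auto simp: in_keys_iff)
    then show ?thesis
      by (simp add: lin_ext_superset[OF assms, of "Poly_Mapping.keys x"] scale_sum_right)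
  qed
  ultimately show ?thesis
    by (simp add: Vector_Spaces.linear_iff vector_space_pm_scale assms)
qed

lemma lin_ext_single:
  assumes "vector_space scaleM"
  shows "lin_ext scaleM \<phi> (Poly_Mapping.single a c) = scaleM c (\<phi> a)"
proof -
  interpret vector_space scaleM by fact
  show ?thesis by (subst lin_ext_superset[OF assms, of "{a}"]) auto
qed


section \<open>The loop-Virasoro algebra\<close>

datatype lvir_basis = L int int | C int

type_synonym lvir = "lvir_basis \<Rightarrow>\<^sub>0 complex"

fun lvir_bracket_basis :: "lvir_basis \<Rightarrow> lvir_basis \<Rightarrow> lvir" where
  "lvir_bracket_basis (L i j) (L k l) =
     Poly_Mapping.single (L (i + k) (j + l)) (of_int (k - i)) +
     (if i + k = 0 then Poly_Mapping.single (C (j + l)) (of_int (i ^ 3 - i) / 12) else 0)"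
| "lvir_bracket_basis (L i j) (C l) = 0"
| "lvir_bracket_basis (C j) (L k l) = 0"
| "lvir_bracket_basis (C j) (C l) = 0"

definition lvir_bracket :: "lvir \<Rightarrow> lvir \<Rightarrow> lvir" where
  "lvir_bracket x y =
     lin_ext pm_scale (\<lambda>a. lin_ext pm_scale (\<lambda>b. lvir_bracket_basis a b) y) x"


section \<open>The action on complex polynomials\<close>

text \<open>The substitution \<open>f(t) \<mapsto> f(t - i)\<close> is \<open>pcompose f [:- i, 1:]\<close>, and \<open>t - i \<alpha>\<close> is the
  polynomial \<open>[:- i \<alpha>, 1:]\<close>.\<close>

fun Omega_act_basis :: "complex \<Rightarrow> complex \<Rightarrow> complex \<Rightarrow> lvir_basis \<Rightarrow> complex poly \<Rightarrow> complex poly"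
  where
  "Omega_act_basis lam \<mu> \<alpha> (L i j) f =
     smult (lam powi (i - j) * \<mu> powi j)
       ([:- of_int i * \<alpha>, 1:] * pcompose f [:- of_int i, 1:])"
| "Omega_act_basis lam \<mu> \<alpha> (C i) f = 0"

definition Omega_act :: "complex \<Rightarrow> complex \<Rightarrow> complex \<Rightarrow> lvir \<Rightarrow> complex poly \<Rightarrow> complex poly" where
  "Omega_act lam \<mu> \<alpha> x f = lin_ext smult (\<lambda>b. Omega_act_basis lam \<mu> \<alpha> b f) x"

text \<open>The (bi)linear extensions satisfy the defining formulas on basis vectors, and
  the bracket is indeed a Lie bracket.\<close>

lemma lvir_bracket_single:
  "lvir_bracket (Poly_Mapping.single a 1) (Poly_Mapping.single b 1) = lvir_bracket_basis a b"
  by (simp add: lvir_bracket_def lin_ext_single vector_space_pm_scale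
      vector_space.vector_space_assms(4)[OF vector_space_pm_scale])

lemma Omega_act_single:
  "Omega_act lam \<mu> \<alpha> (Poly_Mapping.single b 1) f = Omega_act_basis lam \<mu> \<alpha> b f"
  by (simp add: Omega_act_def lin_ext_single vector_space_smult)

lemma linear_eq_on_single:
  assumes "Vector_Spaces.linear pm_scale s f" "Vector_Spaces.linear pm_scale s g"
    and eq: "\<And>a. f (Poly_Mapping.single a 1) = g (Poly_Mapping.single a 1)"
  shows "f x = g x"
proof -
  interpret f: Vector_Spaces.linear pm_scale s f by fact
  interpret g: Vector_Spaces.linear pm_scale s g by fact
  have "x = (\<Sum>a\<in>Poly_Mapping.keys x.
      pm_scale (Poly_Mapping.lookup x a) (Poly_Mapping.single a 1))"
    by (rule poly_mapping_eqI) (auto simp: lookup_sum lookup_single when_def in_keys_iff)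
  then obtain c where x: "x = (\<Sum>a\<in>Poly_Mapping.keys x. pm_scale (c a) (Poly_Mapping.single a 1))"
    by blast
  show ?thesis
    by (subst (1 2) x) (simp add: f.sum g.sum f.scale g.scale eq del: pm_scale_single)
qed

lemma linear_lvir_bracket_left: "Vector_Spaces.linear pm_scale pm_scale (\<lambda>x. lvir_bracket x y)"
  unfolding lvir_bracket_def by (rule linear_lin_ext[OF vector_space_pm_scale])

lemma linear_lvir_bracket_right: "Vector_Spaces.linear pm_scale pm_scale (\<lambda>y. lvir_bracket x y)"
proof -
  interpret vector_space "pm_scale :: complex \<Rightarrow> lvir \<Rightarrow> lvir" by (rule vector_space_pm_scale)
  have *: "Vector_Spaces.linear pm_scale pm_scale (lin_ext pm_scale (lvir_bracket_basis a))" for a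
    by (rule linear_lin_ext[OF vector_space_pm_scale])
  then show ?thesis
    unfolding lvir_bracket_def
    by (simp add: Vector_Spaces.linear_iff lin_ext_def[of _ _ x] scale_right_distrib sum.distrib
        scale_sum_right scale_left_commute del: scale_scale)
qed

lemma lvir_bracket_anticomm: "lvir_bracket x y = - lvir_bracket y x"
proof -
  interpret vector_space "pm_scale :: complex \<Rightarrow> lvir \<Rightarrow> lvir" by (rule vector_space_pm_scale)
  have neg: "Vector_Spaces.linear pm_scale pm_scale (\<lambda>x. - f x)"
    if "Vector_Spaces.linear pm_scale pm_scale f" for f :: "lvir \<Rightarrow> lvir"
    using that by (simp add: Vector_Spaces.linear_iff)
  have basis: "lvir_bracket_basis a b = - lvir_bracket_basis b a" for a b
  proof (cases a; cases b)
    fix i j k l assume ab: "a = L i j" "b = L k l"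
    show ?thesis
    proof (cases "k = - i")
      case True
      show ?thesis unfolding ab True
        by (rule poly_mapping_eqI) (simp add: lookup_add lookup_minus lookup_single when_def add.commute
              field_simps)
    next
      case False
      then have "i + k \<noteq> 0" "k + i \<noteq> 0" by auto
      then show ?thesis unfolding ab
        by (intro poly_mapping_eqI) (simp add: lookup_single when_def add.commute)
    qed
  qed auto
  show ?thesis
  proof (rule linear_eq_on_single[OF linear_lvir_bracket_left neg[OF linear_lvir_bracket_right]])
    fix a
    show "lvir_bracket (Poly_Mapping.single a 1) y = - lvir_bracket y (Poly_Mapping.single a 1)"
      by (rule linear_eq_on_single[OF linear_lvir_bracket_right neg[OF linear_lvir_bracket_left]])
        (simp only: lvir_bracket_single, rule basis)
  qed
qed

lemma lvir_jacobi:
  "lvir_bracket x (lvir_bracket y z) + lvir_bracket y (lvir_bracket z x)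
     + lvir_bracket z (lvir_bracket x y) = 0" (is "?J x y z = 0")
proof -
  interpret vector_space "pm_scale :: complex \<Rightarrow> lvir \<Rightarrow> lvir" by (rule vector_space_pm_scale)
  have lin: "lvir_bracket (u + v) w = lvir_bracket u w + lvir_bracket v w"
    "lvir_bracket (pm_scale c u) w = pm_scale c (lvir_bracket u w)"
    "lvir_bracket w (u + v) = lvir_bracket w u + lvir_bracket w v"
    "lvir_bracket w (pm_scale c u) = pm_scale c (lvir_bracket w u)" for u v w c
    using linear_lvir_bracket_left linear_lvir_bracket_right
    by (simp_all add: Vector_Spaces.linear_iff)
  have linJ: "Vector_Spaces.linear pm_scale pm_scale (\<lambda>x. ?J x y z)"
    "Vector_Spaces.linear pm_scale pm_scale (\<lambda>y. ?J x y z)"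
    "Vector_Spaces.linear pm_scale pm_scale (\<lambda>z. ?J x y z)" for x y z
    by (simp_all add: Vector_Spaces.linear_iff vector_space_pm_scale lin scale_right_distrib)
  have lin0: "Vector_Spaces.linear pm_scale pm_scale (\<lambda>x::lvir. 0::lvir)"
    by (simp add: Vector_Spaces.linear_iff vector_space_pm_scale)
  have zero: "lvir_bracket w 0 = 0" for w
    using lin(3)[of w 0 0] by simp
  have single: "lvir_bracket (Poly_Mapping.single a 1) (Poly_Mapping.single b c)
      = pm_scale c (lvir_bracket_basis a b)" for a b c
    using lin(4)[of "Poly_Mapping.single a 1" c "Poly_Mapping.single b 1"]
    by (simp add: lvir_bracket_single)
  have basis: "?J (Poly_Mapping.single a 1) (Poly_Mapping.single b 1) (Poly_Mapping.single d 1) = 0"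
    for a b d
  proof (cases a; cases b; cases d)
    fix i j k l m n assume abd: "a = L i j" "b = L k l" "d = L m n"
    show ?thesis
    proof (cases "m = - i - k")
      case True
      show ?thesis unfolding abd True
        by (rule poly_mapping_eqI) (simp add: lvir_bracket_single single lin zero lookup_add
            lookup_single when_def add_ac field_simps power3_eq_cube)
    next
      case False
      then show ?thesis unfolding abd
        by (intro poly_mapping_eqI) (simp add: lvir_bracket_single single lin zero lookup_add
            lookup_single when_def add_ac field_simps)
    qed
  qed (auto simp: lvir_bracket_single single lin zero)
  show ?thesis
  proof (rule linear_eq_on_single[OF linJ(1) lin0])
    fix a
    show "?J (Poly_Mapping.single a 1) y z = 0"
    proof (rule linear_eq_on_single[OF linJ(2) lin0])
      fix b
      show "?J (Poly_Mapping.single a 1) (Poly_Mapping.single b 1) z = 0"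
        by (rule linear_eq_on_single[OF linJ(3) lin0]) (rule basis)
    qed
  qed
qed

lemma lie_algebra_lvir: "lie_algebra pm_scale lvir_bracket"
proof (intro lie_algebra.intro lie_algebra_axioms.intro)
  show "vector_space (pm_scale :: complex \<Rightarrow> lvir \<Rightarrow> lvir)" by (rule vector_space_pm_scale)
  show "lvir_bracket x x = 0" for x
  proof (rule poly_mapping_eqI)
    fix k
    have "Poly_Mapping.lookup (lvir_bracket x x) k = - Poly_Mapping.lookup (lvir_bracket x x) k"
      using arg_cong[OF lvir_bracket_anticomm[of x x], of "\<lambda>u. Poly_Mapping.lookup u k"] by simp
    then show "Poly_Mapping.lookup (lvir_bracket x x) k = Poly_Mapping.lookup 0 k" by simp
  qed
qed (rule linear_lvir_bracket_left linear_lvir_bracket_right lvir_jacobi)+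

end

theory Submission
  imports Defs
begin

text \<open>By bilinearity it suffices to compare the two sides on basis vectors. The centre acts by zero
  and \<open>(i, j) \<mapsto> \<lambda>\<^sup>i\<^sup>-\<^sup>j \<mu>\<^sup>j\<close> is multiplicative, so everything reduces to the polynomial identity
  \<open>(t - i\<alpha>) (t - i - k\<alpha>) - (t - k\<alpha>) (t - k - i\<alpha>) = (k - i) (t - (i + k)\<alpha>)\<close>.\<close>

lemma linear_Omega_act_left:
  "Vector_Spaces.linear pm_scale smult (\<lambda>x. Omega_act lam \<mu> \<alpha> x f)"
  unfolding Omega_act_def by (rule linear_lin_ext[OF vector_space_smult])

text \<open>An \<open>L\<close> vector acts by a substitution, multiplication by a fixed polynomial
  and a scaling, all linear in \<open>f\<close>. For general \<open>x\<close> these are summed over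
  the keys of \<open>x\<close>, a set independent of \<open>f\<close>.\<close>

lemma linear_Omega_act_right:
  "Vector_Spaces.linear smult smult (Omega_act lam \<mu> \<alpha> x)"
proof -
  interpret vector_space "smult :: complex \<Rightarrow> complex poly \<Rightarrow> complex poly"
    by (rule vector_space_smult)
  have add: "Omega_act_basis lam \<mu> \<alpha> b (f + g)
      = Omega_act_basis lam \<mu> \<alpha> b f + Omega_act_basis lam \<mu> \<alpha> b g" for b f g
    \<comment> \<open>Without \<open>mult_pCons_left\<close> the factor
      \<open>t - i \<alpha>\<close> stays a single block instead of being multiplied out.\<close>
    by (cases b) (simp_all add: pcompose_add algebra_simps smult_add_right del: mult_pCons_left)
  have scale: "Omega_act_basis lam \<mu> \<alpha> b (smult c f) = smult c (Omega_act_basis lam \<mu> \<alpha> b f)"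
    for b c f
    by (cases b) (simp_all add: pcompose_smult mult_ac del: mult_pCons_left)
  show ?thesis
    by (simp add: Vector_Spaces.linear_iff vector_space_smult Omega_act_def lin_ext_def add scale
        smult_add_right sum.distrib scale_sum_right mult.commute)
qed

lemma Omega_act_basis_bracket:
  assumes "lam \<noteq> 0" and "\<mu> \<noteq> 0"
  shows "Omega_act lam \<mu> \<alpha> (lvir_bracket_basis a b) f =
    Omega_act_basis lam \<mu> \<alpha> a (Omega_act_basis lam \<mu> \<alpha> b f)
    - Omega_act_basis lam \<mu> \<alpha> b (Omega_act_basis lam \<mu> \<alpha> a f)"
proof (cases a; cases b)
  fix i j k l
  assume ab: "a = L i j" "b = L k l"
  have add: "Omega_act lam \<mu> \<alpha> (x + y) f = Omega_act lam \<mu> \<alpha> x f + Omega_act lam \<mu> \<alpha> y f" for x y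
    using linear_Omega_act_left by (simp add: Vector_Spaces.linear_iff)
  have single: "Omega_act lam \<mu> \<alpha> (Poly_Mapping.single c d) f
      = smult d (Omega_act_basis lam \<mu> \<alpha> c f)" for c d
    by (simp add: Omega_act_def lin_ext_single vector_space_smult)
  have "Omega_act lam \<mu> \<alpha> (lvir_bracket_basis a b) f
      = smult (of_int (k - i)) (Omega_act_basis lam \<mu> \<alpha> (L (i + k) (j + l)) f)"
    \<comment> \<open>If \<open>i + k \<noteq> 0\<close>, the central term is the zero vector, whose
      action is an empty sum; hence the second unfolding.\<close>
    by (simp add: ab add single)
      (simp add: Omega_act_def lin_ext_def)
  also have "\<dots> = Omega_act_basis lam \<mu> \<alpha> a (Omega_act_basis lam \<mu> \<alpha> b f)
    - Omega_act_basis lam \<mu> \<alpha> b (Omega_act_basis lam \<mu> \<alpha> a f)"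
  proof -
    \<comment> \<open>The exponents \<open>i - j\<close> and \<open>j\<close> are additive in the
      indices. They may be negative, so splitting the powers uses that \<open>lam\<close> and
      \<open>\<mu>\<close> are nonzero.\<close>
    have coeff: "lam powi (i + k - (j + l)) * \<mu> powi (j + l)
        = (lam powi (i - j) * \<mu> powi j) * (lam powi (k - l) * \<mu> powi l)"
      using assms power_int_add[of lam "i - j" "k - l"]
      by (simp add: power_int_add algebra_simps)
    show ?thesis
      unfolding ab Omega_act_basis.simps coeff
      \<comment> \<open>Over an infinite field it suffices to compare values. At a point
        \<open>t\<close>, every term carries the common factor \<open>f(t - i - k)\<close>, which
        leaves the quadratic identity.\<close>
      by (rule poly_ext) (simp add: poly_pcompose algebra_simps)
  qed
  finally show ?thesis .
qed (simp_all add: Omega_act_def lin_ext_def)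

theorem proposition2p2:
  fixes lam \<mu> \<alpha> :: complex
  assumes "lam \<noteq> 0" and "\<mu> \<noteq> 0"
  shows "lie_module pm_scale lvir_bracket smult (Omega_act lam \<mu> \<alpha>)"
proof (intro lie_module.intro lie_module_axioms.intro)
  let ?A = "Omega_act lam \<mu> \<alpha>"
  show "lie_algebra pm_scale lvir_bracket"
    by (rule lie_algebra_lvir)
  show "vector_space (smult :: complex \<Rightarrow> complex poly \<Rightarrow> complex poly)"
    by (rule vector_space_smult)
  show "Vector_Spaces.linear pm_scale smult (\<lambda>x. ?A x v)" for v
    by (rule linear_Omega_act_left)
  show "Vector_Spaces.linear smult smult (?A x)" for x
    by (rule linear_Omega_act_right)
  show "?A (lvir_bracket x y) v = ?A x (?A y v) - ?A y (?A x v)" for x y v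
  proof -
    have lin: "lvir_bracket (x + x') y = lvir_bracket x y + lvir_bracket x' y"
      "lvir_bracket (pm_scale c x) y = pm_scale c (lvir_bracket x y)"
      "lvir_bracket x (y + y') = lvir_bracket x y + lvir_bracket x y'"
      "lvir_bracket x (pm_scale c y) = pm_scale c (lvir_bracket x y)"
      "?A (x + x') f = ?A x f + ?A x' f" "?A (pm_scale c x) f = smult c (?A x f)"
      "?A x (f + g) = ?A x f + ?A x g" "?A x (smult c f) = smult c (?A x f)"
      for x x' y y' c f g
      using linear_lvir_bracket_left linear_lvir_bracket_right
        linear_Omega_act_left linear_Omega_act_right[of lam \<mu> \<alpha>]
      by (simp_all add: Vector_Spaces.linear_iff)
    have bracket: "Vector_Spaces.linear pm_scale smult (\<lambda>x. ?A (lvir_bracket x y) v)"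
      "Vector_Spaces.linear pm_scale smult (\<lambda>y. ?A (lvir_bracket x y) v)" for x y
      by (simp_all add: Vector_Spaces.linear_iff vector_space_pm_scale vector_space_smult lin)
    have commutator: "Vector_Spaces.linear pm_scale smult (\<lambda>x. ?A x (?A y v) - ?A y (?A x v))"
      "Vector_Spaces.linear pm_scale smult (\<lambda>y. ?A x (?A y v) - ?A y (?A x v))" for x y
      by (simp_all add: Vector_Spaces.linear_iff vector_space_pm_scale vector_space_smult lin
          smult_diff_right)
    show ?thesis
    \<comment> \<open>First \<open>x\<close> is reduced to a basis vector with \<open>y\<close>
      arbitrary, then \<open>y\<close>; the polynomial \<open>v\<close> stays arbitrary
      throughout.\<close>
    proof (rule linear_eq_on_single[OF bracket(1) commutator(1)])
      fix a
      let ?a = "Poly_Mapping.single a 1 :: lvir"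
      show "?A (lvir_bracket ?a y) v = ?A ?a (?A y v) - ?A y (?A ?a v)"
        by (rule linear_eq_on_single[OF bracket(2) commutator(2)])
          (simp only: lvir_bracket_single Omega_act_single Omega_act_basis_bracket[OF assms])
    qed
  qed
qed

end
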